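(* The number of valid Septoku boards (maps $s:\{1,\dots,37\}\to\{1,\dots,7\}$ satisfying the Septoku rules, with no identification by symmetries or symbol permutations) is exactly $120{,}960 = 24\cdot 7!$.
   Context: The Septoku board consists of 37 cells forming a regular hexagon of side 4 in a hexagonal grid, numbered row by row: $1$–$4$ (top row), $5$–$9$, $10$–$15$, $16$–$22$, $23$–$28$, $29$–$33$, $34$–$37$ (bottom row). The 21 "rows" of the board are: horizontal $\{1,2,3,4\}$, $\{5,\dots,9\}$, $\{10,\dots,15\}$, $\{16,\dots,22\}$, $\{23,\dots,28\}$, $\{29,\dots,33\}$, $\{34,\dots,37\}$; up-right $\{1,5,10,16\}$, $\{2,6,11,17,23\}$, $\{3,7,12,18,24,29\}$, $\{4,8,13,19,25,30,34\}$, $\{9,14,20,26,31,35\}$, $\{15,21,27,32,36\}$, $\{22,28,33,37\}$; down-right $\{4,9,15,22\}$, $\{3,8,14,21,28\}$, $\{2,7,13,20,27,33\}$, $\{1,6,12,19,26,32,37\}$, $\{5,11,18,25,31,36\}$, $\{10,17,24,30,35\}$, $\{16,23,29,34\}$. The seven "circles" are: $\{1,2,5,6,7,11,12\}$, $\{3,4,7,8,9,13,14\}$, $\{10,11,16,17,18,23,24\}$, $\{12,13,18,19,20,25,26\}$, $\{14,15,20,21,22,27,28\}$, $\{24,25,29,30,31,34,35\}$, $\{26,27,31,32,33,36,37\}$. A valid Septoku board is a map $s:\{1,\dots,37\}\to\{1,\dots,7\}$ such that the cells of each of the 21 rows receive pairwise distinct values and the seven cells of each circle receive pairwise distinct values.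 *)

theory Defs
  imports "HOL-Library.FuncSet"
begin

(* The cells of the regular hexagon of side 4, numbered row by row from the top:
              1  2  3  4
            5  6  7  8  9
          10 11 12 13 14 15
        16 17 18 19 20 21 22
          23 24 25 26 27 28
            29 30 31 32 33
              34 35 36 37                                                       *)
definition septoku_cells :: "nat set" where
  "septoku_cells = {1..37}"

definition septoku_symbols :: "nat set" where
  "septoku_symbols = {1..7}"

definition horizontal_rows :: "nat set set" where
  "horizontal_rows =
    {{1, 2, 3, 4},
     {5, 6, 7, 8, 9},
     {10, 11, 12, 13, 14, 15},
     {16, 17, 18, 19, 20, 21, 22},
     {23, 24, 25, 26, 27, 28},
     {29, 30, 31, 32, 33},
     {34, 35, 36, 37}}"

definition up_right_rows :: "nat set set" where
  "up_right_rows =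
    {{1, 5, 10, 16},
     {2, 6, 11, 17, 23},
     {3, 7, 12, 18, 24, 29},
     {4, 8, 13, 19, 25, 30, 34},
     {9, 14, 20, 26, 31, 35},
     {15, 21, 27, 32, 36},
     {22, 28, 33, 37}}"

definition down_right_rows :: "nat set set" where
  "down_right_rows =
    {{4, 9, 15, 22},
     {3, 8, 14, 21, 28},
     {2, 7, 13, 20, 27, 33},
     {1, 6, 12, 19, 26, 32, 37},
     {5, 11, 18, 25, 31, 36},
     {10, 17, 24, 30, 35},
     {16, 23, 29, 34}}"

definition septoku_rows :: "nat set set" where
  "septoku_rows = horizontal_rows \<union> up_right_rows \<union> down_right_rows"

definition septoku_circles :: "nat set set" where
  "septoku_circles =
    {{1, 2, 5, 6, 7, 11, 12},
     {3, 4, 7, 8, 9, 13, 14},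
     {10, 11, 16, 17, 18, 23, 24},
     {12, 13, 18, 19, 20, 25, 26},
     {14, 15, 20, 21, 22, 27, 28},
     {24, 25, 29, 30, 31, 34, 35},
     {26, 27, 31, 32, 33, 36, 37}}"

(* The extensional function space makes each map from cells to symbols correspond to
   exactly one HOL function: outside the board the value is fixed to undefined. *)
definition valid_septoku_board :: "(nat \<Rightarrow> nat) \<Rightarrow> bool" where
  "valid_septoku_board s \<longleftrightarrow>
     s \<in> septoku_cells \<rightarrow>\<^sub>E septoku_symbols \<and>
     (\<forall>R \<in> septoku_rows. inj_on s R) \<and>
     (\<forall>C \<in> septoku_circles. inj_on s C)"

end

theory Submission
  imports Defs
begin

text \<open>A valid board is a proper colouring, with palette \<open>{1..7}\<close>, of the graph that joins two cells
  sharing a row or a circle. The central circle is a clique on seven cells, so its values form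
  one of the \<open>7!\<close> arrangements of the palette, and permuting the palette shows that each arrangement
  extends to the whole board in the same number of ways. For the arrangement \<open>1, \<dots>, 7\<close> a
  backtracking search finds 24 extensions.\<close>

section \<open>Proper colourings of a graph\<close>

definition proper_on :: "('a \<Rightarrow> 'a \<Rightarrow> bool) \<Rightarrow> 'a set \<Rightarrow> ('a \<Rightarrow> 'c) \<Rightarrow> bool" where
  "proper_on adj A s \<longleftrightarrow> (\<forall>c\<in>A. \<forall>d\<in>A. c \<noteq> d \<longrightarrow> adj c d \<longrightarrow> s c \<noteq> s d)"

lemma proper_on_insert:
  assumes "symp adj" "v \<notin> A"
  shows "proper_on adj (insert v A) s \<longleftrightarrow> proper_on adj A s \<and> (\<forall>c\<in>A. adj v c \<longrightarrow> s v \<noteq> s c)"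
  using assms unfolding proper_on_def symp_def by (auto; metis)

lemma proper_on_subset: "proper_on adj A s \<Longrightarrow> B \<subseteq> A \<Longrightarrow> proper_on adj B s"
  unfolding proper_on_def by blast

subsection \<open>Counting proper colourings by backtracking\<close>

text \<open>Vertices are coloured in a fixed order. The colours chosen so far are kept as a list, latest
  first, and the mask of a vertex marks the earlier vertices adjacent to it.\<close>

fun masks :: "('a \<Rightarrow> 'a \<Rightarrow> bool) \<Rightarrow> 'a list \<Rightarrow> 'a list \<Rightarrow> bool list list" where
  "masks adj ps [] = []"
| "masks adj ps (v # vs) = map (adj v) ps # masks adj (v # ps) vs"

fun masked :: "bool list \<Rightarrow> 'c list \<Rightarrow> 'c list" where
  "masked (b # bs) (x # xs) = (if b then x # masked bs xs else masked bs xs)"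
| "masked _ _ = []"

fun admissible :: "bool list list \<Rightarrow> 'c list \<Rightarrow> 'c list \<Rightarrow> bool" where
  "admissible [] xs ys \<longleftrightarrow> ys = []"
| "admissible (m # ms) xs [] \<longleftrightarrow> False"
| "admissible (m # ms) xs (y # ys) \<longleftrightarrow> y \<notin> set (masked m xs) \<and> admissible ms (y # xs) ys"

definition extensions :: "'c set \<Rightarrow> bool list list \<Rightarrow> 'c list \<Rightarrow> 'c list set" where
  "extensions K ms xs = {ys. set ys \<subseteq> K \<and> admissible ms xs ys}"

text \<open>The branches are enumerated by recursion on the list of candidates rather than by \<open>map\<close>,
  because the simplifier would unfold the search under the abstraction.\<close>

fun count_branches :: "'c list \<Rightarrow> bool list list \<Rightarrow> 'c list \<Rightarrow> 'c list \<Rightarrow> nat" where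
  "count_branches K [] xs vs = length vs"
| "count_branches K (m # ms) xs [] = 0"
| "count_branches K (m # ms) xs (v # vs) =
     count_branches K ms (v # xs) (fold removeAll (masked m (v # xs)) K) +
     count_branches K (m # ms) xs vs"

fun count_extensions :: "'c list \<Rightarrow> bool list list \<Rightarrow> 'c list \<Rightarrow> nat" where
  "count_extensions K [] xs = 1"
| "count_extensions K (m # ms) xs = count_branches K ms xs (fold removeAll (masked m xs) K)"

lemma fold_removeAll: "fold removeAll xs K = filter (\<lambda>y. y \<notin> set xs) K"
proof (induction xs arbitrary: K)
  case (Cons x xs)
  have "filter (\<lambda>y. y \<notin> set xs) (removeAll x K) = filter (\<lambda>y. y \<notin> set (x # xs)) K"
    by (induction K) auto
  then show ?case using Cons by simp
qed simp

lemma set_masked_subset: "set (masked m xs) \<subseteq> set xs"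
  by (induction m xs rule: masked.induct) auto

lemma masked_map: "masked m (map f xs) = map f (masked m xs)"
  by (induction m xs rule: masked.induct) auto

lemma set_masked_map_map: "set (masked (map P ps) (map s ps)) = s ` {p \<in> set ps. P p}"
  by (induction ps) auto

lemma length_masks: "length (masks adj ps vs) = length vs"
  by (induction vs arbitrary: ps) auto

lemma admissible_length: "admissible ms xs ys \<Longrightarrow> length ys = length ms"
  by (induction ms xs ys rule: admissible.induct) auto

text \<open>Admissibility only tests colours for equality, so renaming them injectively does not
  affect it.\<close>

lemma admissible_map_inj:
  "inj_on p (set xs \<union> set ys) \<Longrightarrow> admissible ms (map p xs) (map p ys) \<longleftrightarrow> admissible ms xs ys"
proof (induction ms xs ys rule: admissible.induct)
  case (3 m ms xs y ys)
  have "set xs \<union> set (y # ys) = set (y # xs) \<union> set ys"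
    by auto
  then have "admissible ms (map p (y # xs)) (map p ys) \<longleftrightarrow> admissible ms (y # xs) ys"
    using 3 by metis
  moreover have "p y \<in> p ` set (masked m xs) \<longleftrightarrow> y \<in> set (masked m xs)"
    using "3.prems" set_masked_subset[of m xs]
    by (intro inj_on_image_mem_iff[of p "set xs \<union> set (y # ys)"]) auto
  ultimately show ?case by (simp add: masked_map)
qed auto

text \<open>The mask of a vertex selects exactly the colours of its earlier neighbours. As
  \<open>adj\<close> is symmetric, comparing each new vertex with the earlier ones covers every
  edge.\<close>

lemma admissible_masks_iff_proper_on:
  assumes "symp adj" "distinct (ps @ vs)" "proper_on adj (set ps) s"
  shows "admissible (masks adj ps vs) (map s ps) (map s vs) \<longleftrightarrow> proper_on adj (set ps \<union> set vs) s"
  using assms(2,3)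
proof (induction vs arbitrary: ps)
  case (Cons v vs)
  have *: "proper_on adj (set (v # ps)) s \<longleftrightarrow> s v \<notin> set (masked (map (adj v) ps) (map s ps))"
    using Cons.prems proper_on_insert[OF assms(1), of v "set ps" s]
    by (auto simp: set_masked_map_map)
  show ?case
  proof (cases "proper_on adj (set (v # ps)) s")
    case True
    then show ?thesis using * Cons.IH[of "v # ps"] Cons.prems by simp
  next
    case False
    \<comment> \<open>A conflict at \<open>v\<close> persists in every larger vertex set, so both
      sides are false.\<close>
    then show ?thesis using * proper_on_subset[of adj "set ps \<union> set (v # vs)" s "set (v # ps)"]
      by auto
  qed
qed simp

lemma finite_extensions: "finite K \<Longrightarrow> finite (extensions K ms xs)"
  unfolding extensions_def
  by (rule finite_subset[OF _ finite_lists_length_eq[of K "length ms"]])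
    (auto dest: admissible_length)

lemma extensions_Nil: "extensions K [] xs = {[]}"
  by (auto simp: extensions_def)

lemma extensions_Cons:
  "extensions K (m # ms) xs =
    (\<Union>v\<in>{v \<in> K. v \<notin> set (masked m xs)}. (#) v ` extensions K ms (v # xs))"
proof (intro set_eqI)
  fix ys
  show "ys \<in> extensions K (m # ms) xs \<longleftrightarrow>
    ys \<in> (\<Union>v\<in>{v \<in> K. v \<notin> set (masked m xs)}. (#) v ` extensions K ms (v # xs))"
    by (cases ys) (auto simp: extensions_def)
qed

lemma card_extensions_Cons:
  assumes "distinct K"
  shows "card (extensions (set K) (m # ms) xs) =
    (\<Sum>v\<leftarrow>fold removeAll (masked m xs) K. card (extensions (set K) ms (v # xs)))"
proof -
  have "card (extensions (set K) (m # ms) xs) =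
    (\<Sum>v\<in>{v \<in> set K. v \<notin> set (masked m xs)}. card ((#) v ` extensions (set K) ms (v # xs)))"
    unfolding extensions_Cons by (rule card_UN_disjoint) (auto simp: finite_extensions)
  also have "\<dots> = (\<Sum>v\<in>{v \<in> set K. v \<notin> set (masked m xs)}. card (extensions (set K) ms (v # xs)))"
    by (simp add: card_image)
  also have "{v \<in> set K. v \<notin> set (masked m xs)} = set (fold removeAll (masked m xs) K)"
    by (simp add: fold_removeAll)
  finally show ?thesis
    using assms by (subst sum_list_distinct_conv_sum_set) (simp_all add: fold_removeAll)
qed

text \<open>Here \<open>vs\<close> holds the untried colours of the current vertex and
  \<open>xs\<close> the colours chosen before it. Once no masks remain, each candidate has just the
  empty extension, hence the value \<open>length vs\<close>.\<close>

lemma count_branches_eq: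
  assumes "distinct K"
  shows "count_branches K ms xs vs = (\<Sum>v\<leftarrow>vs. card (extensions (set K) ms (v # xs)))"
  using assms
  by (induction K ms xs vs rule: count_branches.induct)
    (simp_all add: extensions_Nil card_extensions_Cons sum_list_triv)

lemma card_extensions:
  "distinct K \<Longrightarrow> card (extensions (set K) ms xs) = count_extensions K ms xs"
  by (cases ms) (simp_all add: extensions_Nil card_extensions_Cons count_branches_eq)

section \<open>Invariance under permutations of the palette\<close>

lemma card_extensions_permute:
  assumes K: "finite K" and xs: "distinct xs" "set xs = K" and xs': "distinct xs'" "set xs' = K"
  shows "card (extensions K ms xs) = card (extensions K ms xs')"
proof -
  have len: "length xs = length xs'"
    using xs xs' by (metis distinct_card)
  \<comment> \<open>\<open>p\<close> sends each entry of \<open>xs\<close> to the entry of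
    \<open>xs'\<close> at the same position.\<close>
  define p where "p x = the (map_of (zip xs xs') x)" for x
  have p: "map p xs = xs'"
    by (rule nth_equalityI) (use xs len in \<open>auto simp: p_def map_of_zip_nth\<close>)
  have pK: "p ` K = K"
    using p xs(2) xs'(2) by (metis list.set_map)
  \<comment> \<open>A map of a finite set onto itself is injective.\<close>
  then have inj: "inj_on p K"
    using K by (simp add: eq_card_imp_inj_on)
  have "map p ` extensions K ms xs = extensions K ms xs'"
  proof (intro equalityI subsetI)
    fix zs assume "zs \<in> map p ` extensions K ms xs"
    then obtain ys where ys: "zs = map p ys" "set ys \<subseteq> K" "admissible ms xs ys"
      by (auto simp: extensions_def)
    have "admissible ms (map p xs) (map p ys)"
      using admissible_map_inj[of p xs ys ms] inj ys xs(2) by (simp add: Un_absorb2)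
    then show "zs \<in> extensions K ms xs'"
      using ys pK p by (auto simp: extensions_def)
  next
    fix zs assume "zs \<in> extensions K ms xs'"
    then have zs: "set zs \<subseteq> K" "admissible ms xs' zs"
      by (auto simp: extensions_def)
    then have "zs \<in> lists (p ` K)"
      using pK by auto
    then obtain ys where ys: "zs = map p ys" "set ys \<subseteq> K"
      unfolding lists_image by auto
    then have "admissible ms xs ys"
      using admissible_map_inj[of p xs ys ms] inj zs p xs(2) by (simp add: Un_absorb2)
    then show "zs \<in> map p ` extensions K ms xs"
      using ys by (auto simp: extensions_def)
  qed
  moreover have "inj_on (map p) (extensions K ms xs)"
    by (rule inj_on_subset[OF inj_on_mapI[of p "extensions K ms xs"]])
      (use inj in \<open>auto simp: extensions_def intro: inj_on_subset\<close>)
  ultimately show ?thesis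
    using card_image by metis
qed

subsection \<open>Colourings as lists\<close>

text \<open>Extensionality makes the map injective; surjectivity then follows because both sides
  have \<open>card K ^ length ks\<close> elements.\<close>

lemma bij_betw_map_PiE:
  assumes "distinct ks" "finite K"
  shows "bij_betw (\<lambda>s. map s ks) (set ks \<rightarrow>\<^sub>E K) {zs. set zs \<subseteq> K \<and> length zs = length ks}"
    (is "bij_betw ?f ?A ?B")
proof -
  have inj: "inj_on ?f ?A"
    by (rule inj_onI) (auto intro: PiE_ext)
  moreover have "?f ` ?A = ?B"
  proof (rule card_subset_eq)
    show "card (?f ` ?A) = card ?B"
      using assms card_image[OF inj]
      by (simp add: card_PiE card_lists_length_eq distinct_card)
  qed (auto simp: assms finite_lists_length_eq)
  ultimately show ?thesis by (simp add: bij_betw_def)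
qed

text \<open>A proper colouring splits uniquely into its values on the clique \<open>cs\<close>,
  which are pairwise distinct, and an extension of them to \<open>vs\<close>.\<close>

lemma card_colourings_clique:
  fixes K :: "'c set" and cs vs :: "'a list"
  assumes "symp adj" "distinct (cs @ vs)" "finite K"
    and clique: "\<And>c d. c \<in> set cs \<Longrightarrow> d \<in> set cs \<Longrightarrow> adj c d"
  shows "card {s \<in> set (cs @ vs) \<rightarrow>\<^sub>E K. proper_on adj (set (cs @ vs)) s} =
    (\<Sum>xs | set xs \<subseteq> K \<and> length xs = length cs \<and> distinct xs.
      card (extensions K (masks adj cs vs) xs))"
proof -
  let ?S = "{s \<in> set (cs @ vs) \<rightarrow>\<^sub>E K. proper_on adj (set (cs @ vs)) s}"
  let ?X = "{xs. set xs \<subseteq> K \<and> length xs = length cs \<and> distinct xs}"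
  let ?T = "SIGMA xs:?X. extensions K (masks adj cs vs) xs"
  let ?f = "\<lambda>s. map s (cs @ vs)"
  have bij: "bij_betw ?f (set (cs @ vs) \<rightarrow>\<^sub>E K) {zs. set zs \<subseteq> K \<and> length zs = length (cs @ vs)}"
    using assms(2,3) by (rule bij_betw_map_PiE)
  have proper_cs: "proper_on adj (set cs) s \<longleftrightarrow> distinct (map s cs)" for s :: "'a \<Rightarrow> 'c"
    using assms(2) clique by (auto simp: proper_on_def distinct_map inj_on_def)
  have proper: "proper_on adj (set (cs @ vs)) s \<longleftrightarrow>
      distinct (map s cs) \<and> admissible (masks adj cs vs) (map s cs) (map s vs)" for s :: "'a \<Rightarrow> 'c"
    using admissible_masks_iff_proper_on[OF assms(1,2)] proper_cs
      proper_on_subset[of adj "set (cs @ vs)" s "set cs"]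
    by auto
  have "?f ` ?S = (\<lambda>(xs, ys). xs @ ys) ` ?T"
  proof (intro equalityI subsetI)
    fix zs assume "zs \<in> ?f ` ?S"
    then obtain s where s: "zs = ?f s" "s \<in> set (cs @ vs) \<rightarrow>\<^sub>E K" "proper_on adj (set (cs @ vs)) s"
      by auto
    then have "(map s cs, map s vs) \<in> ?T"
      using proper[of s] by (auto simp: extensions_def)
    then show "zs \<in> (\<lambda>(xs, ys). xs @ ys) ` ?T"
      using s(1) by force
  next
    fix zs assume "zs \<in> (\<lambda>(xs, ys). xs @ ys) ` ?T"
    then obtain xs ys where xy: "zs = xs @ ys" "xs \<in> ?X" "ys \<in> extensions K (masks adj cs vs) xs"
      by auto
    then have "zs \<in> {zs. set zs \<subseteq> K \<and> length zs = length (cs @ vs)}"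
      by (auto simp: extensions_def length_masks dest: admissible_length)
    then obtain s where s: "zs = ?f s" "s \<in> set (cs @ vs) \<rightarrow>\<^sub>E K"
      using bij unfolding bij_betw_def by blast
    then have "xs = map s cs" "ys = map s vs"
      using xy by auto
    then have "s \<in> ?S"
      using xy s(2) proper[of s] by (simp add: extensions_def)
    then show "zs \<in> ?f ` ?S"
      using s(1) by blast
  qed
  moreover have "inj_on ?f ?S"
    by (rule inj_on_subset[OF bij_betw_imp_inj_on[OF bij]]) auto
  \<comment> \<open>All first components have length \<open>length cs\<close>, so a concatenation
    determines both parts.\<close>
  moreover have "inj_on (\<lambda>(xs, ys). xs @ ys) ?T"
    by (auto simp: inj_on_def)
  ultimately have "card ?S = card ?T"
    using card_image[of ?f ?S] card_image[of "\<lambda>(xs, ys). xs @ ys" ?T] by simp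
  also have "\<dots> = (\<Sum>xs\<in>?X. card (extensions K (masks adj cs vs) xs))"
  proof (rule card_SigmaI)
    show "finite ?X"
      by (rule finite_subset[OF _ finite_lists_length_eq[OF assms(3), of "length cs"]]) auto
  qed (simp add: finite_extensions assms(3))
  finally show ?thesis .
qed

subsection \<open>The Septoku board\<close>

text \<open>Every cell of the board clashes with itself; this is harmless because
  \<open>proper_on\<close> compares distinct cells only.\<close>

definition clash :: "nat \<Rightarrow> nat \<Rightarrow> bool" where
  "clash c d \<longleftrightarrow> (\<exists>U \<in> septoku_rows \<union> septoku_circles. c \<in> U \<and> d \<in> U)"

definition central_cells :: "nat list" where
  "central_cells = [12, 13, 18, 19, 20, 25, 26]"

text \<open>The order was found by local search; it keeps the search tree to about 2600 nodes.\<close>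

definition outer_cells :: "nat list" where
  "outer_cells = [31, 27, 14, 24, 11, 15, 10, 36, 5, 7, 9, 35, 23, 28, 29, 3, 33, 2, 16, 17, 34,
     30, 32, 37, 21, 8, 6, 4, 1, 22]"

lemma distinct_cells: "distinct (central_cells @ outer_cells)"
  by (simp add: central_cells_def outer_cells_def)

lemma set_cells: "set (central_cells @ outer_cells) = septoku_cells"
proof (rule card_subset_eq)
  show "card (set (central_cells @ outer_cells)) = card septoku_cells"
    unfolding distinct_card[OF distinct_cells]
    by (simp add: central_cells_def outer_cells_def septoku_cells_def)
qed (simp_all add: central_cells_def outer_cells_def septoku_cells_def)

text \<open>Injectivity on each row and circle is a condition on pairs of cells, and all these sets
  lie within the board.\<close>

lemma valid_iff_proper_on:
  "valid_septoku_board s \<longleftrightarrow>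
    s \<in> septoku_cells \<rightarrow>\<^sub>E septoku_symbols \<and> proper_on clash septoku_cells s"
proof -
  have "\<forall>U \<in> septoku_rows \<union> septoku_circles. U \<subseteq> septoku_cells"
    unfolding septoku_rows_def horizontal_rows_def up_right_rows_def down_right_rows_def
      septoku_circles_def septoku_cells_def by simp
  then have "proper_on clash septoku_cells s \<longleftrightarrow>
      (\<forall>U \<in> septoku_rows \<union> septoku_circles. inj_on s U)"
    unfolding proper_on_def clash_def inj_on_def by blast
  then show ?thesis
    unfolding valid_septoku_board_def by blast
qed

lemma symp_clash: "symp clash"
  unfolding symp_def clash_def by blast

lemma clash_central: "c \<in> set central_cells \<Longrightarrow> d \<in> set central_cells \<Longrightarrow> clash c d"
  unfolding clash_def
  by (rule bexI[of _ "set central_cells"]) (simp_all add: septoku_circles_def central_cells_def)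

text \<open>Spells out adjacency as explicit conditions on cell numbers, so that the simplifier can
  evaluate the masks.\<close>

lemmas clash_iff = clash_def[unfolded septoku_rows_def horizontal_rows_def up_right_rows_def
    down_right_rows_def septoku_circles_def, simplified]

lemma count_extensions_septoku:
  "count_extensions [1, 2, 3, 4, 5, 6, 7 :: nat] (masks clash central_cells outer_cells)
     [1, 2, 3, 4, 5, 6, 7] = 24"
  by (simp add: clash_iff central_cells_def outer_cells_def)

lemma card_septoku_extensions:
  assumes "set xs \<subseteq> septoku_symbols" "length xs = 7" "distinct xs"
  shows "card (extensions septoku_symbols (masks clash central_cells outer_cells) xs) = 24"
proof -
  have sym: "septoku_symbols = set [1, 2, 3, 4, 5, 6, 7]"
    unfolding septoku_symbols_def by auto
  \<comment> \<open>Seven distinct symbols exhaust the palette, so \<open>xs\<close> is a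
    rearrangement of the list for which the search was run.\<close>
  have "set xs = septoku_symbols"
    using assms by (intro card_subset_eq) (simp_all add: distinct_card septoku_symbols_def)
  then have "card (extensions septoku_symbols (masks clash central_cells outer_cells) xs) =
    card (extensions septoku_symbols (masks clash central_cells outer_cells) [1, 2, 3, 4, 5, 6, 7])"
    using assms(3) sym by (intro card_extensions_permute) (simp_all add: septoku_symbols_def)
  also have "\<dots> = 24"
    unfolding sym by (subst card_extensions) (simp_all only: count_extensions_septoku, simp)
  finally show ?thesis .
qed

theorem theorem5:
  shows "card {s. valid_septoku_board s} = 120960 \<and> (120960::nat) = 24 * fact 7"
proof -
  let ?X = "{xs. set xs \<subseteq> septoku_symbols \<and> length xs = length central_cells \<and> distinct xs}"
  have len: "length central_cells = 7"
    by (simp add: central_cells_def)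
  have "{s. valid_septoku_board s} =
    {s \<in> set (central_cells @ outer_cells) \<rightarrow>\<^sub>E septoku_symbols.
      proper_on clash (set (central_cells @ outer_cells)) s}"
    by (simp only: valid_iff_proper_on set_cells)
  then have "card {s. valid_septoku_board s} =
    (\<Sum>xs\<in>?X. card (extensions septoku_symbols (masks clash central_cells outer_cells) xs))"
    by (simp only:, intro card_colourings_clique symp_clash clash_central distinct_cells)
      (simp_all add: septoku_symbols_def)
  also have "\<dots> = (\<Sum>xs\<in>?X. 24)"
    by (rule sum.cong) (simp_all add: card_septoku_extensions len)
  also have "\<dots> = 24 * card {xs. length xs = 7 \<and> distinct xs \<and> set xs \<subseteq> septoku_symbols}"
    by (simp add: len conj_ac)
  \<comment> \<open>The count of distinct lists is a falling product, here running over all of 1 to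
    7.\<close>
  also have "card {xs. length xs = 7 \<and> distinct xs \<and> set xs \<subseteq> septoku_symbols} = fact 7"
    by (subst card_lists_distinct_length_eq) (simp_all add: septoku_symbols_def fact_prod)
  finally show ?thesis
    by (simp add: fact_numeral)
qed

end
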